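(* Let $\mathbb{A}_1,\mathbb{A}_2\in\mathbb{R}^{n\times n}$ (not necessarily symmetric), let $\mathcal{P}$ be a compact parameter set, let $\theta_1,\theta_2:\mathcal{P}\to\mathbb{R}$, and assume that $\mathbb{A}(\mu)=\theta_1(\mu)\mathbb{A}_1+\theta_2(\mu)\mathbb{A}_2$ is invertible for every $\mu\in\mathcal{P}$. Let $\mathbf{f}\in\mathbb{R}^n$ and let $\mathbf{u}_\mu$ be the solution of $\mathbb{A}(\mu)\mathbf{u}_\mu=\mathbf{f}$. Let $\mu_0,\mu_1\in\mathcal{P}$, $\mathbb{B}=\mathbb{A}(\mu_0)^{-1}$, let $m>0$ be an integer, and let $\mathbf{r}_0^*\in\mathbb{R}^n$ be the vector selected in the algorithm $\mathrm{RKBM}_2(\mathbb{B},\mathcal{P},\mu_0,\mu_1,m)$. Set $\mathcal{K}_m^{\mu}=\mathcal{K}_m(\mathbb{B}\mathbb{A}(\mu),\mathbb{B}\mathbf{f})$ and $\mathcal{L}_m^{\mu}=\mathcal{K}_m(\mathbb{B}^t\mathbb{A}(\mu)^t,\mathbb{B}^t\mathbf{r}_0^* )$. Assume \[ \theta_1(\mu_0)\theta_2(\mu_1)-\theta_2(\mu_0)\theta_1(\mu_1)\neq0 . \] Let $\mu\in\mathcal{P}$ satisfy $\theta_1(\mu_0)\theta_2(\mu)-\theta_2(\mu_0)\theta_1(\mu)\neq0$, and assume that there exist symmetric positive-definite matrices $\mathbb{M},\mathbb{M}'\in\mathbb{R}^{n\times n}$ and constants $\alpha(\mu),\beta(\mu)>0$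 such that \[ (\mathbb{A}(\mu)\mathbf{v},\mathbf{w})\leq\alpha(\mu)\|\mathbf{v}\|_{\mathbb{M}}\|\mathbf{w}\|_{\mathbb{M}'}\quad\text{for all }\mathbf{v},\mathbf{w}\in\mathbb{R}^n, \] \[ \inf_{\mathbf{0}\neq\mathbf{v}\in\mathcal{K}_m^\mu}\ \sup_{\mathbf{0}\neq\mathbf{w}\in\mathcal{L}_m^\mu}\frac{(\mathbb{A}(\mu)\mathbf{v},\mathbf{w})}{\|\mathbf{v}\|_{\mathbb{M}}\|\mathbf{w}\|_{\mathbb{M}'}}\geq\beta(\mu). \] Then the reduced basis solution $\hat{\mathbf{u}}_\mu$ produced by $\mathrm{RKBM}_2(\mathbb{B},\mathcal{P},\mu_0,\mu_1,m)$ satisfies \[ \|\mathbf{u}_\mu-\hat{\mathbf{u}}_\mu\|_{\mathbb{M}}\leq\frac{\alpha(\mu)}{\beta(\mu)}\inf_{\mathbf{v}\in\mathcal{K}_m^{\mu}}\|\mathbf{u}_\mu-\mathbf{v}\|_{\mathbb{M}} . \]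
   Context: $(\cdot,\cdot)$ and $\|\cdot\|$ are the Euclidean inner product and norm on $\mathbb{R}^n$; for a symmetric positive-definite $\mathbb{C}$, $\|\mathbf{v}\|_{\mathbb{C}}:=\sqrt{(\mathbb{C}\mathbf{v},\mathbf{v})}$; the superscript $t$ is the transpose. For $\mathbb{C}\in\mathbb{R}^{n\times n}$, $\mathcal{K}_m(\mathbb{C},\mathbf{v}):=\mathrm{Span}\{\mathbf{v},\mathbb{C}\mathbf{v},\ldots,\mathbb{C}^{m-1}\mathbf{v}\}$. The algorithm $\mathrm{RKBM}_2(\mathbb{B},\mathcal{P},\mu_0,\mu_1,m)$ (Reduced Krylov Basis Method of the second kind) is as follows. Offline stage: set $\mathbf{u}_0=\mathbf{0}$, $\mathbf{r}_0=\mathbf{f}$, $\mathbf{p}_0=\mathbf{z}_0=\mathbb{B}\mathbf{r}_0$; select some $\mathbf{r}_0^*$ with $(\mathbf{r}_0,\mathbf{r}_0^* )\neq0$ and set $\mathbf{p}_0^*=\mathbf{z}_0^*=\mathbb{B}^t\mathbf{r}_0^*$. For $k=1,\ldots,m-1$ set $\alpha_k=(\mathbf{r}_{k-1},\mathbf{z}^*_{k-1})/(\mathbb{A}(\mu_1)\mathbf{p}_{k-1},\mathbf{p}^*_{k-1})$, $\mathbf{u}_k=\mathbf{u}_{k-1}+\alpha_k\mathbf{p}_{k-1}$, $\mathbf{r}_k=\mathbf{r}_{k-1}-\alpha_k\mathbb{A}(\mu_1)\mathbf{p}_{k-1}$, $\mathbf{r}^*_k=\mathbf{r}^*_{k-1}-\alpha_k\mathbb{A}(\mu_1)^t\mathbf{p}^*_{k-1}$,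 $\mathbf{z}_k=\mathbb{B}\mathbf{r}_k$, $\mathbf{z}^*_k=\mathbb{B}^t\mathbf{r}^*_k$, $\beta_k=(\mathbf{r}_k,\mathbf{z}^*_k)/(\mathbf{r}_{k-1},\mathbf{z}^*_{k-1})$, $\mathbf{p}_k=\mathbf{z}_k+\beta_k\mathbf{p}_{k-1}$, $\mathbf{p}^*_k=\mathbf{z}^*_k+\beta_k\mathbf{p}^*_{k-1}$. Set $\mathbb{P}=\left[\mathbf{p}_0/\|\mathbf{p}_0\|,\ldots,\mathbf{p}_{m-1}/\|\mathbf{p}_{m-1}\|\right]$, $\mathbb{Q}=\left[\mathbf{p}^*_0/\|\mathbf{p}^*_0\|,\ldots,\mathbf{p}^*_{m-1}/\|\mathbf{p}^*_{m-1}\|\right]$, and let $\mathcal{K}_m$ and $\mathcal{L}_m$ be the column spaces of $\mathbb{P}$ and $\mathbb{Q}$. Online stage: for each $\mu\in\mathcal{P}$, $\hat{\mathbf{u}}_\mu\in\mathcal{K}_m$ is determined by $(\mathbb{A}(\mu)\hat{\mathbf{u}}_\mu,\mathbf{v})=(\mathbf{f},\mathbf{v})$ for all $\mathbf{v}\in\mathcal{L}_m$; equivalently $\hat{\mathbf{u}}_\mu=\mathbb{P}(\mathbb{Q}^t\mathbb{A}(\mu)\mathbb{P})^{-1}\mathbb{Q}^t\mathbf{f}$. The algorithm is understood to be well defined: all denominators occurring above are nonzero, and $\mathbb{Q}^t\mathbb{A}(\mu)\mathbb{P}$ is invertible for the parameter $\mu$ under consideration. *)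

theory Defs
  imports "HOL-Analysis.Analysis"
begin

text \<open>
  The power \<open>C ^ k\<close> on the type \<open>real ^ 'n ^ 'n\<close> is componentwise, so powers of a matrix are
  written as iterates of its action on vectors.
\<close>

definition krylov :: "nat \<Rightarrow> real ^ 'n ^ 'n \<Rightarrow> real ^ 'n \<Rightarrow> (real ^ 'n) set" where
  "krylov m C v = span ((\<lambda>k. ((\<lambda>x. C *v x) ^^ k) v) ` {..<m})"

definition sym_pos_def :: "real ^ 'n ^ 'n \<Rightarrow> bool" where
  "sym_pos_def C \<longleftrightarrow> transpose C = C \<and> (\<forall>v. v \<noteq> 0 \<longrightarrow> (C *v v) \<bullet> v > 0)"

definition mat_norm :: "real ^ 'n ^ 'n \<Rightarrow> real ^ 'n \<Rightarrow> real" where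
  "mat_norm C v = sqrt ((C *v v) \<bullet> v)"

text \<open>
  One state of the offline iteration; a trailing \<open>s\<close> in a field name stands for the superscript
  star.
\<close>

datatype 'v rkbm2_state =
  State (uvec: 'v) (rvec: 'v) (zvec: 'v) (pvec: 'v) (rvecs: 'v) (zvecs: 'v) (pvecs: 'v)

definition rkbm2_init ::
  "real ^ 'n ^ 'n \<Rightarrow> real ^ 'n \<Rightarrow> real ^ 'n \<Rightarrow> (real ^ 'n) rkbm2_state" where
  "rkbm2_init B f r0s =
     State 0 f (B *v f) (B *v f) r0s (transpose B *v r0s) (transpose B *v r0s)"

definition rkbm2_step ::
  "real ^ 'n ^ 'n \<Rightarrow> real ^ 'n ^ 'n \<Rightarrow> (real ^ 'n) rkbm2_state \<Rightarrow> (real ^ 'n) rkbm2_state" where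
  "rkbm2_step B Amu1 s =
     (let a  = (rvec s \<bullet> zvecs s) / ((Amu1 *v pvec s) \<bullet> pvecs s);
          u  = uvec s + a *\<^sub>R pvec s;
          r  = rvec s - a *\<^sub>R (Amu1 *v pvec s);
          rs = rvecs s - a *\<^sub>R (transpose Amu1 *v pvecs s);
          z  = B *v r;
          zs = transpose B *v rs;
          b  = (r \<bullet> zs) / (rvec s \<bullet> zvecs s);
          p  = z + b *\<^sub>R pvec s;
          ps = zs + b *\<^sub>R pvecs s
      in State u r z p rs zs ps)"

text \<open>
  \<open>rkbm2_offline B Amu1 f r0s k\<close> holds the vectors with index \<open>k\<close>; here \<open>Amu1\<close> is the system matrix
  at the offline parameter \<open>\<mu>\<^sub>1\<close>.
\<close>

primrec rkbm2_offline ::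
  "real ^ 'n ^ 'n \<Rightarrow> real ^ 'n ^ 'n \<Rightarrow> real ^ 'n \<Rightarrow> real ^ 'n \<Rightarrow> nat \<Rightarrow> (real ^ 'n) rkbm2_state"
where
  "rkbm2_offline B Amu1 f r0s 0 = rkbm2_init B f r0s"
| "rkbm2_offline B Amu1 f r0s (Suc k) = rkbm2_step B Amu1 (rkbm2_offline B Amu1 f r0s k)"

text \<open>
  The \<open>m\<close> columns of the two basis matrices are indexed by a finite type \<open>'m\<close>, where
  \<open>idx\<close> maps \<open>'m\<close> bijectively onto \<open>{..<m}\<close> and gives the position of each column.
\<close>

definition rkbm2_P ::
  "('m \<Rightarrow> nat) \<Rightarrow> real ^ 'n ^ 'n \<Rightarrow> real ^ 'n ^ 'n \<Rightarrow> real ^ 'n \<Rightarrow> real ^ 'n \<Rightarrow> real ^ 'm ^ 'n"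
where
  "rkbm2_P idx B Amu1 f r0s =
     (\<chi> i j. let p = pvec (rkbm2_offline B Amu1 f r0s (idx j)) in p $ i / norm p)"

definition rkbm2_Q ::
  "('m \<Rightarrow> nat) \<Rightarrow> real ^ 'n ^ 'n \<Rightarrow> real ^ 'n ^ 'n \<Rightarrow> real ^ 'n \<Rightarrow> real ^ 'n \<Rightarrow> real ^ 'm ^ 'n"
where
  "rkbm2_Q idx B Amu1 f r0s =
     (\<chi> i j. let ps = pvecs (rkbm2_offline B Amu1 f r0s (idx j)) in ps $ i / norm ps)"

text \<open>
  The step from index \<open>k\<close> to \<open>Suc k\<close> is carried out for \<open>k < m - 1\<close> only, so the
  denominators of the two step sizes are required to be nonzero for these \<open>k\<close>, whereas the norms
  occur for all \<open>k < m\<close>.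
\<close>

definition rkbm2_offline_ok ::
  "nat \<Rightarrow> real ^ 'n ^ 'n \<Rightarrow> real ^ 'n ^ 'n \<Rightarrow> real ^ 'n \<Rightarrow> real ^ 'n \<Rightarrow> bool" where
  "rkbm2_offline_ok m B Amu1 f r0s \<longleftrightarrow>
     f \<bullet> r0s \<noteq> 0 \<and>
     (\<forall>k. Suc k < m \<longrightarrow>
        (let s = rkbm2_offline B Amu1 f r0s k in
           (Amu1 *v pvec s) \<bullet> pvecs s \<noteq> 0 \<and> rvec s \<bullet> zvecs s \<noteq> 0)) \<and>
     (\<forall>k<m. let s = rkbm2_offline B Amu1 f r0s k in
        norm (pvec s) \<noteq> 0 \<and> norm (pvecs s) \<noteq> 0)"

definition rkbm2_online_solution ::
  "real ^ 'm ^ 'n \<Rightarrow> real ^ 'm ^ 'n \<Rightarrow> real ^ 'n ^ 'n \<Rightarrow> real ^ 'n \<Rightarrow> real ^ 'n \<Rightarrow> bool" where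
  "rkbm2_online_solution P Q A f u \<longleftrightarrow>
     u \<in> span (columns P) \<and> (\<forall>v \<in> span (columns Q). (A *v u) \<bullet> v = f \<bullet> v)"

end

theory Submission
  imports Defs
begin

text \<open>
  Modulo \<open>A(\<mu>\<^sub>0)\<close>, the matrices \<open>A(\<mu>\<^sub>1)\<close> and \<open>A(\<mu>)\<close> are multiples of each other, so
  the search directions of the offline stage lie in the Krylov spaces generated by \<open>B A(\<mu>)\<close>. The
  online matrix being invertible, the bases have full rank \<open>m\<close>, and a dimension count identifies
  their spans with these Krylov spaces. The estimate is then the one for Petrov-Galerkin
  projections; it has the constant \<open>\<alpha> / \<beta>\<close> instead of \<open>1 + \<alpha> / \<beta>\<close> because a bound for a
  nonzero oblique projection of an inner product space is also a bound for the complementary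
  projection.
\<close>

section \<open>Krylov spaces\<close>

lemma subspace_krylov: "subspace (krylov m C v)"
  by (simp add: krylov_def)

lemma krylov_mono:
  assumes "m \<le> l"
  shows "krylov m C v \<subseteq> krylov l C v"
  unfolding krylov_def using assms by (intro span_mono) auto

lemma krylov_initial: "v \<in> krylov (Suc m) C v"
  unfolding krylov_def by (rule span_base) (force intro: image_eqI[where x = 0])

lemma krylov_mult:
  assumes "x \<in> krylov m C v"
  shows "C *v x \<in> krylov (Suc m) C v"
proof -
  let ?g = "\<lambda>k. ((\<lambda>x. C *v x) ^^ k) v"
  have "C *v x \<in> (\<lambda>x. C *v x) ` span (?g ` {..<m})"
    using assms by (auto simp: krylov_def)
  also have "\<dots> = span ((\<lambda>x. C *v x) ` ?g ` {..<m})"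
    by (rule linear_span_image[symmetric]) simp
  also have "\<dots> \<subseteq> span (?g ` {..<Suc m})"
  proof (rule span_mono, clarify)
    fix k assume "k < m"
    then show "C *v ?g k \<in> ?g ` {..<Suc m}"
      by (intro image_eqI[where x = "Suc k"]) auto
  qed
  finally show ?thesis by (simp add: krylov_def)
qed

text \<open>By induction, \<open>k\<close> applications of \<open>C\<close> give a polynomial of
  degree at most \<open>k\<close> in \<open>D\<close>. The reverse inclusion is later replaced by a
  comparison of dimensions.\<close>

lemma krylov_affine_subset:
  assumes "\<And>x. C *v x = a *\<^sub>R x + b *\<^sub>R (D *v x)"
  shows "krylov m C v \<subseteq> krylov m D v"
proof -
  have power: "((\<lambda>x. C *v x) ^^ k) v \<in> krylov (Suc k) D v" for k
  proof (induction k)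
    case 0
    then show ?case by (simp add: krylov_initial)
  next
    case (Suc k)
    then have "((\<lambda>x. C *v x) ^^ k) v \<in> krylov (Suc (Suc k)) D v"
      using krylov_mono[of "Suc k" "Suc (Suc k)"] by auto
    with krylov_mult[OF Suc] show ?case
      by (simp add: assms subspace_add subspace_scale subspace_krylov)
  qed
  show ?thesis
    unfolding krylov_def[of m C]
  proof (rule span_minimal[OF _ subspace_krylov], clarify)
    fix k assume "k < m"
    then show "((\<lambda>x. C *v x) ^^ k) v \<in> krylov m D v"
      using power[of k] krylov_mono[of "Suc k" m] by auto
  qed
qed

lemma dim_krylov_le: "dim (krylov m C v) \<le> m"
proof -
  let ?G = "(\<lambda>k. ((\<lambda>x. C *v x) ^^ k) v) ` {..<m}"
  have "dim (krylov m C v) \<le> card ?G"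
    unfolding krylov_def dim_span by (rule dim_le_card') simp
  also have "\<dots> \<le> m"
    using card_image_le[of "{..<m}"] by simp
  finally show ?thesis .
qed

section \<open>The offline bases\<close>

lemma offline_zvec:
  "zvec (rkbm2_offline B C f r0s k) = B *v rvec (rkbm2_offline B C f r0s k)"
  "zvecs (rkbm2_offline B C f r0s k) = transpose B *v rvecs (rkbm2_offline B C f r0s k)"
  by (cases k; simp add: rkbm2_init_def rkbm2_step_def Let_def)+

text \<open>One offline step after preconditioning: with \<open>D = B ** C\<close>, the residual
  update turns into \<open>z - a *\<^sub>R (D *v p)\<close>, and adding \<open>b *\<^sub>R p\<close>
  gives the next direction. With transposed matrices it serves the dual recursion too.\<close>

lemma conjugate_direction_in_krylov:
  assumes "z \<in> krylov (Suc k) D v" "p \<in> krylov (Suc k) D v"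
  shows "z - a *\<^sub>R (D *v p) \<in> krylov (Suc (Suc k)) D v"
    and "z - a *\<^sub>R (D *v p) + b *\<^sub>R p \<in> krylov (Suc (Suc k)) D v"
  using assms krylov_mult[OF assms(2)] krylov_mono[of "Suc k" "Suc (Suc k)" D v]
  by (auto intro!: subspace_add subspace_diff subspace_scale subspace_krylov)

lemma offline_in_krylov:
  "zvec (rkbm2_offline B C f r0s k) \<in> krylov (Suc k) (B ** C) (B *v f) \<and>
   pvec (rkbm2_offline B C f r0s k) \<in> krylov (Suc k) (B ** C) (B *v f)"
proof (induction k)
  case 0
  then show ?case by (simp add: rkbm2_init_def krylov_initial)
next
  case (Suc k)
  then show ?case
    by (simp add: rkbm2_step_def Let_def conjugate_direction_in_krylov offline_zvec
        matrix_vector_mult_diff_distrib matrix_vector_mult_scaleR matrix_vector_mul_assoc)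
qed

lemma offline_in_krylov_dual:
  "zvecs (rkbm2_offline B C f r0s k)
     \<in> krylov (Suc k) (transpose B ** transpose C) (transpose B *v r0s) \<and>
   pvecs (rkbm2_offline B C f r0s k)
     \<in> krylov (Suc k) (transpose B ** transpose C) (transpose B *v r0s)"
proof (induction k)
  case 0
  then show ?case
    by (simp add: rkbm2_init_def krylov_initial del: transpose_matrix_vector)
next
  case (Suc k)
  then show ?case
    by (simp add: rkbm2_step_def Let_def conjugate_direction_in_krylov offline_zvec
        matrix_vector_mult_diff_distrib matrix_vector_mult_scaleR matrix_vector_mul_assoc
        del: transpose_matrix_vector)
qed

section \<open>Column spans and rank of the basis matrices\<close>

lemma column_rkbm2_P:
  "column j (rkbm2_P idx B C f r0s) =
     (1 / norm (pvec (rkbm2_offline B C f r0s (idx j)))) *\<^sub>R pvec (rkbm2_offline B C f r0s (idx j))"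
  by (simp add: vec_eq_iff column_def rkbm2_P_def Let_def)

lemma column_rkbm2_Q:
  "column j (rkbm2_Q idx B C f r0s) =
     (1 / norm (pvecs (rkbm2_offline B C f r0s (idx j)))) *\<^sub>R pvecs (rkbm2_offline B C f r0s (idx j))"
  by (simp add: vec_eq_iff column_def rkbm2_Q_def Let_def)

lemma span_columns_rkbm2_P_subset:
  assumes "\<And>j. idx j < m"
  shows "span (columns (rkbm2_P idx B C f r0s)) \<subseteq> krylov m (B ** C) (B *v f)"
proof (rule span_minimal[OF _ subspace_krylov], clarify)
  fix x assume "x \<in> columns (rkbm2_P idx B C f r0s)"
  then obtain j where "x = column j (rkbm2_P idx B C f r0s)"
    by (auto simp: columns_def)
  then show "x \<in> krylov m (B ** C) (B *v f)"
    unfolding column_rkbm2_P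
    using offline_in_krylov[of B C f r0s "idx j"] krylov_mono[of "Suc (idx j)" m] assms[of j]
    by (auto intro!: subspace_scale subspace_krylov)
qed

lemma span_columns_rkbm2_Q_subset:
  assumes "\<And>j. idx j < m"
  shows "span (columns (rkbm2_Q idx B C f r0s))
    \<subseteq> krylov m (transpose B ** transpose C) (transpose B *v r0s)"
proof (rule span_minimal[OF _ subspace_krylov], clarify)
  fix x assume "x \<in> columns (rkbm2_Q idx B C f r0s)"
  then obtain j where "x = column j (rkbm2_Q idx B C f r0s)"
    by (auto simp: columns_def)
  then show "x \<in> krylov m (transpose B ** transpose C) (transpose B *v r0s)"
    unfolding column_rkbm2_Q
    using offline_in_krylov_dual[of B C f r0s "idx j"] krylov_mono[of "Suc (idx j)" m] assms[of j]
    by (auto intro!: subspace_scale subspace_krylov simp del: transpose_matrix_vector)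
qed

text \<open>A left inverse of \<open>N ** P\<close>, multiplied by \<open>N\<close>, is a left
  inverse of \<open>P\<close>, so \<open>P\<close> has full column rank.\<close>

lemma dim_columns_invertible_mult:
  fixes P :: "real ^ 'm ^ 'n" and N :: "real ^ 'n ^ 'm"
  assumes "invertible (N ** P)"
  shows "dim (span (columns P)) = CARD('m)"
proof -
  obtain X where "X ** (N ** P) = mat 1"
    using assms by (auto simp: invertible_def)
  then have "(X ** N) ** P = mat 1"
    by (simp add: matrix_mul_assoc)
  then have "inj (\<lambda>x. P *v x)"
    using matrix_left_invertible_injective by blast
  then have "rank P = CARD('m)"
    by (simp add: full_rank_injective)
  then show ?thesis
    by (simp add: column_rank_def)
qed

section \<open>Oblique projections\<close>

lemma mat_norm_scaleR: "mat_norm M (c *\<^sub>R v) = \<bar>c\<bar> * mat_norm M v"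
proof -
  have "mat_norm M (c *\<^sub>R v) = sqrt (c\<^sup>2 * ((M *v v) \<bullet> v))"
    by (simp add: mat_norm_def matrix_vector_mult_scaleR power2_eq_square)
  then show ?thesis
    by (simp add: mat_norm_def real_sqrt_mult)
qed

lemma sym_pos_def_pos:
  assumes "sym_pos_def M"
  shows "v \<noteq> 0 \<Longrightarrow> mat_norm M v > 0" and "mat_norm M v \<ge> 0"
  using assms by (cases "v = 0"; force simp: sym_pos_def_def mat_norm_def)+

lemma mat_norm_add_squared:
  assumes "sym_pos_def M"
  shows "(mat_norm M (v + w))\<^sup>2 = (mat_norm M v)\<^sup>2 + (mat_norm M w)\<^sup>2 + 2 * ((M *v v) \<bullet> w)"
proof -
  have nonneg: "(M *v x) \<bullet> x \<ge> 0" for x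
    using assms by (cases "x = 0") (auto simp: sym_pos_def_def less_imp_le)
  have "(M *v w) \<bullet> v = (M *v v) \<bullet> w"
    using assms dot_lmul_matrix[of w M v] by (simp add: sym_pos_def_def inner_commute
        flip: transpose_matrix_vector)
  then show ?thesis
    using nonneg[of v] nonneg[of w] nonneg[of "v + w"]
    by (simp add: mat_norm_def matrix_vector_right_distrib inner_add)
qed

text \<open>
  The vector \<open>y\<close> obtained from \<open>e + p\<close> by exchanging the norms of the two components has
  the same norm as \<open>e + p\<close>, and its component along \<open>p\<close> has the norm of \<open>e\<close>.
\<close>

lemma complementary_projection_bound:
  assumes M: "sym_pos_def M"
    and K: "subspace K" "K \<noteq> {0}"
    and N: "subspace N"
    and bound: "\<And>p e. p \<in> K \<Longrightarrow> e \<in> N \<Longrightarrow> mat_norm M p \<le> c * mat_norm M (e + p)"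
    and p: "p \<in> K" and e: "e \<in> N"
  shows "mat_norm M e \<le> c * mat_norm M (e + p)"
proof -
  \<comment> \<open>Testing the bound with a nonzero \<open>k\<close> and \<open>e = 0\<close>
    forces \<open>c \<ge> 1\<close>, which settles the case \<open>p = 0\<close> below.\<close>
  obtain k where k: "k \<in> K" "k \<noteq> 0"
    using K subspace_0 by blast
  have "mat_norm M k \<le> c * mat_norm M k"
    using bound[OF k(1) subspace_0[OF N]] by simp
  then have c: "c \<ge> 1"
    using sym_pos_def_pos(1)[OF M k(2)] by simp
  note nonneg = sym_pos_def_pos(2)[OF M]
  show ?thesis
  proof (cases "p = 0 \<or> e = 0")
    case True
    then show ?thesis
      using c nonneg mult_right_mono[of 1 c "mat_norm M e"]
      by (auto simp: mat_norm_def[of _ 0])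
  next
    case False
    define s where "s = mat_norm M p / mat_norm M e"
    have norm_pos: "mat_norm M p > 0" "mat_norm M e > 0"
      using False sym_pos_def_pos(1)[OF M] by auto
    then have s: "s > 0" by (simp add: s_def)
    define y where "y = s *\<^sub>R e + (1 / s) *\<^sub>R p"
    have e': "mat_norm M ((1 / s) *\<^sub>R p) = mat_norm M e"
      using s norm_pos by (simp add: mat_norm_scaleR s_def)
    have p': "mat_norm M (s *\<^sub>R e) = mat_norm M p"
      using s norm_pos by (simp add: mat_norm_scaleR s_def)
    \<comment> \<open>The squared norms of the two components trade places, and \<open>s\<close>
      cancels against \<open>1 / s\<close> in the cross term.\<close>
    have "(mat_norm M y)\<^sup>2 = (mat_norm M (e + p))\<^sup>2"
      unfolding y_def mat_norm_add_squared[OF M] e' p'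
      using s by (simp add: matrix_vector_mult_scaleR)
    then have "mat_norm M y = mat_norm M (e + p)"
      using nonneg by simp
    moreover have "mat_norm M ((1 / s) *\<^sub>R p) \<le> c * mat_norm M y"
      unfolding y_def using p e K N by (intro bound subspace_scale) auto
    ultimately show ?thesis
      by (simp only: e')
  qed
qed

text \<open>Since \<open>A *v e\<close> is orthogonal to \<open>L\<close>, adding \<open>e\<close>
  to \<open>p\<close> does not change the pairing with \<open>L\<close>. Continuity bounds this
  pairing from above, the inf-sup condition from below. This bounds the projection onto
  \<open>K\<close> along such vectors \<open>e\<close>.\<close>

lemma inf_sup_stability:
  fixes A M M' :: "real ^ 'n ^ 'n"
  assumes spd: "sym_pos_def M" "sym_pos_def M'"
    and beta: "\<beta> > 0"
    and continuity: "\<And>v w. (A *v v) \<bullet> w \<le> \<alpha> * mat_norm M v * mat_norm M' w"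
    and L: "L - {0} \<noteq> {}"
    and inf_sup:
      "(INF v \<in> K - {0}. SUP w \<in> L - {0}. ((A *v v) \<bullet> w) / (mat_norm M v * mat_norm M' w)) \<ge> \<beta>"
    and p: "p \<in> K"
    and e: "\<And>w. w \<in> L \<Longrightarrow> (A *v e) \<bullet> w = 0"
  shows "mat_norm M p \<le> \<alpha> / \<beta> * mat_norm M (e + p)"
proof -
  define q where "q = (\<lambda>v w. ((A *v v) \<bullet> w) / (mat_norm M v * mat_norm M' w))"
  note pos = sym_pos_def_pos(1)[OF spd(1)] sym_pos_def_pos(1)[OF spd(2)]
  have q_le: "q v w \<le> \<alpha>" if "v \<noteq> 0" "w \<noteq> 0" for v w
    unfolding q_def using continuity[of v w] pos that
    by (simp add: pos_divide_le_eq mult.assoc)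
  have neg: "q (- v) w = - q v w" for v w
    using mat_norm_scaleR[of M "- 1" v] matrix_vector_mult_scaleR[of A "- 1" v]
    by (simp add: q_def)
  \<comment> \<open>A real \<open>SUP\<close> or \<open>INF\<close> bounds its family only if the
    family is bounded, so both bounds are checked before single elements are compared.\<close>
  have bdd_q: "bdd_above (q v ` (L - {0}))" if "v \<noteq> 0" for v
    using q_le that by (intro bdd_aboveI2[where M = \<alpha>]) auto
  obtain w0 where w0: "w0 \<in> L - {0}"
    using L by blast
  \<comment> \<open>The quotient is odd in \<open>v\<close>, so its upper bound at
    \<open>- v\<close> is a lower bound at \<open>v\<close>; one fixed \<open>w0\<close>
    suffices.\<close>
  have "- \<alpha> \<le> (SUP w \<in> L - {0}. q v w)" if "v \<noteq> 0" for v
    using cSUP_upper[OF w0 bdd_q[OF that]] q_le[of "- v" w0] w0 that by (simp add: neg)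
  then have bdd: "bdd_below ((\<lambda>v. SUP w \<in> L - {0}. q v w) ` (K - {0}))"
    by (intro bdd_belowI2[where m = "- \<alpha>"]) auto
  have alpha: "0 \<le> \<alpha>"
    using q_le[of w0 w0] q_le[of "- w0" w0] w0 by (simp add: neg)
  show ?thesis
  proof (cases "p = 0")
    case True
    then show ?thesis
      using alpha beta sym_pos_def_pos(2)[OF spd(1)] by (simp add: mat_norm_def[of _ 0])
  next
    case False
    have "\<beta> \<le> (SUP w \<in> L - {0}. q p w)"
      using inf_sup cINF_lower[OF bdd, of p] p False by (simp add: q_def)
    also have "\<dots> \<le> \<alpha> * mat_norm M (e + p) / mat_norm M p"
    proof (rule cSUP_least[OF L])
      fix w assume w: "w \<in> L - {0}"
      then have "(A *v p) \<bullet> w = (A *v (e + p)) \<bullet> w"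
        by (simp add: matrix_vector_right_distrib inner_add e)
      also have "\<dots> \<le> \<alpha> * mat_norm M (e + p) * mat_norm M' w"
        by (rule continuity)
      finally show "q p w \<le> \<alpha> * mat_norm M (e + p) / mat_norm M p"
        unfolding q_def using w pos(1)[OF False] pos(2)[of w] by (simp add: field_simps)
    qed
    finally show ?thesis
      using pos(1)[OF False] beta by (simp add: field_simps)
  qed
qed

text \<open>For \<open>v\<close> in \<open>K\<close>, split \<open>u - v\<close> into the error
  \<open>u - u_hat\<close>, whose image under \<open>A\<close> is orthogonal to \<open>L\<close>,
  and \<open>u_hat - v\<close> in \<open>K\<close>. The complementary projection bound then controls
  the error directly, without a triangle inequality.\<close>

lemma petrov_galerkin_quasi_optimal:
  fixes A M M' :: "real ^ 'n ^ 'n"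
  assumes spd: "sym_pos_def M" "sym_pos_def M'"
    and const_pos: "\<alpha> > 0" "\<beta> > 0"
    and continuity: "\<And>v w. (A *v v) \<bullet> w \<le> \<alpha> * mat_norm M v * mat_norm M' w"
    and K: "subspace K" "K \<noteq> {0}"
    and L: "L - {0} \<noteq> {}"
    and inf_sup:
      "(INF v \<in> K - {0}. SUP w \<in> L - {0}. ((A *v v) \<bullet> w) / (mat_norm M v * mat_norm M' w)) \<ge> \<beta>"
    and u_hat: "u_hat \<in> K" "\<And>w. w \<in> L \<Longrightarrow> (A *v u_hat) \<bullet> w = (A *v u) \<bullet> w"
  shows "mat_norm M (u - u_hat) \<le> \<alpha> / \<beta> * (INF v \<in> K. mat_norm M (u - v))"
proof -
  define N where "N = {e. \<forall>w \<in> L. (A *v e) \<bullet> w = 0}"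
  have N: "subspace N"
    by (auto simp: N_def subspace_def matrix_vector_right_distrib inner_add
        matrix_vector_mult_scaleR)
  have e: "u - u_hat \<in> N"
    by (simp add: N_def matrix_vector_mult_diff_distrib inner_diff u_hat)
  have stability: "mat_norm M p \<le> \<alpha> / \<beta> * mat_norm M (e + p)" if "p \<in> K" "e \<in> N" for p e
    using that by (intro inf_sup_stability[OF spd const_pos(2) continuity L inf_sup])
      (auto simp: N_def)
  \<comment> \<open>The constant is moved to the left so that the claim becomes a lower bound for
    the plain infimum.\<close>
  have "\<beta> / \<alpha> * mat_norm M (u - u_hat) \<le> (INF v \<in> K. mat_norm M (u - v))"
  proof (rule cINF_greatest)
    show "K \<noteq> {}"
      using u_hat by auto
  next
    fix v assume v: "v \<in> K"
    have "mat_norm M (u - u_hat) \<le> \<alpha> / \<beta> * mat_norm M (u - u_hat + (u_hat - v))"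
      using complementary_projection_bound[OF spd(1) K N stability _ e]
        subspace_diff[OF K(1) u_hat(1) v] by blast
    then show "\<beta> / \<alpha> * mat_norm M (u - u_hat) \<le> mat_norm M (u - v)"
      using const_pos by (simp add: field_simps)
  qed
  then show ?thesis
    using const_pos by (simp add: field_simps)
qed

section \<open>Identification of the trial and test spaces, and the error estimate\<close>

theorem theorem3p2:
  fixes A\<^sub>1 A\<^sub>2 B M M' :: "real ^ 'n ^ 'n"
    and A :: "'p::topological_space \<Rightarrow> real ^ 'n ^ 'n"
    and \<P> :: "'p set"
    and \<theta>\<^sub>1 \<theta>\<^sub>2 :: "'p \<Rightarrow> real"
    and \<mu>\<^sub>0 \<mu>\<^sub>1 \<mu> :: 'p
    and f r0s u u_hat :: "real ^ 'n"
    and m :: nat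
    and idx :: "'m::finite \<Rightarrow> nat"
    and P Q :: "real ^ 'm ^ 'n"
    and K L :: "(real ^ 'n) set"
    and \<alpha> \<beta> :: real
  assumes "compact \<P>"
    and A: "\<And>\<nu>. \<nu> \<in> \<P> \<Longrightarrow> A \<nu> = \<theta>\<^sub>1 \<nu> *\<^sub>R A\<^sub>1 + \<theta>\<^sub>2 \<nu> *\<^sub>R A\<^sub>2"
    and A_inv: "\<And>\<nu>. \<nu> \<in> \<P> \<Longrightarrow> invertible (A \<nu>)"
    and params: "\<mu>\<^sub>0 \<in> \<P>" "\<mu>\<^sub>1 \<in> \<P>" "\<mu> \<in> \<P>"
    and B: "B = matrix_inv (A \<mu>\<^sub>0)"
    and u: "A \<mu> *v u = f"
    and m_pos: "m > 0"
    and idx: "bij_betw idx UNIV {..<m}"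
    and offline_ok: "rkbm2_offline_ok m B (A \<mu>\<^sub>1) f r0s"
    and P: "P = rkbm2_P idx B (A \<mu>\<^sub>1) f r0s"
    and Q: "Q = rkbm2_Q idx B (A \<mu>\<^sub>1) f r0s"
    and online_ok: "invertible (transpose Q ** A \<mu> ** P)"
    and u_hat: "rkbm2_online_solution P Q (A \<mu>) f u_hat"
    and K: "K = krylov m (B ** A \<mu>) (B *v f)"
    and L: "L = krylov m (transpose B ** transpose (A \<mu>)) (transpose B *v r0s)"
    and det1: "\<theta>\<^sub>1 \<mu>\<^sub>0 * \<theta>\<^sub>2 \<mu>\<^sub>1 - \<theta>\<^sub>2 \<mu>\<^sub>0 * \<theta>\<^sub>1 \<mu>\<^sub>1 \<noteq> 0"
    and det: "\<theta>\<^sub>1 \<mu>\<^sub>0 * \<theta>\<^sub>2 \<mu> - \<theta>\<^sub>2 \<mu>\<^sub>0 * \<theta>\<^sub>1 \<mu> \<noteq> 0"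
    and spd: "sym_pos_def M" "sym_pos_def M'"
    and const_pos: "\<alpha> > 0" "\<beta> > 0"
    and continuity: "\<And>v w. (A \<mu> *v v) \<bullet> w \<le> \<alpha> * mat_norm M v * mat_norm M' w"
    and inf_sup:
      "(INF v \<in> K - {0}. SUP w \<in> L - {0}. ((A \<mu> *v v) \<bullet> w) / (mat_norm M v * mat_norm M' w)) \<ge> \<beta>"
  shows "mat_norm M (u - u_hat) \<le> \<alpha> / \<beta> * (INF v \<in> K. mat_norm M (u - v))"
proof -
  \<comment> \<open>Cramer's rule for writing the coefficient pair at \<open>\<mu>\<^sub>1\<close>
    as a combination of those at \<open>\<mu>\<^sub>0\<close> and \<open>\<mu>\<close>; the
    determinant is nonzero by \<open>det\<close>.\<close>
  define a where "a = (\<theta>\<^sub>1 \<mu>\<^sub>1 * \<theta>\<^sub>2 \<mu> - \<theta>\<^sub>2 \<mu>\<^sub>1 * \<theta>\<^sub>1 \<mu>) / (\<theta>\<^sub>1 \<mu>\<^sub>0 * \<theta>\<^sub>2 \<mu> - \<theta>\<^sub>2 \<mu>\<^sub>0 * \<theta>\<^sub>1 \<mu>)"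
  define b where "b = (\<theta>\<^sub>1 \<mu>\<^sub>0 * \<theta>\<^sub>2 \<mu>\<^sub>1 - \<theta>\<^sub>2 \<mu>\<^sub>0 * \<theta>\<^sub>1 \<mu>\<^sub>1) / (\<theta>\<^sub>1 \<mu>\<^sub>0 * \<theta>\<^sub>2 \<mu> - \<theta>\<^sub>2 \<mu>\<^sub>0 * \<theta>\<^sub>1 \<mu>)"
  have coeff: "\<theta>\<^sub>1 \<mu>\<^sub>1 = a * \<theta>\<^sub>1 \<mu>\<^sub>0 + b * \<theta>\<^sub>1 \<mu>" "\<theta>\<^sub>2 \<mu>\<^sub>1 = a * \<theta>\<^sub>2 \<mu>\<^sub>0 + b * \<theta>\<^sub>2 \<mu>"
    using det unfolding a_def b_def by (simp_all add: divide_simps) (simp_all add: algebra_simps)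
  have A1: "A \<mu>\<^sub>1 = a *\<^sub>R A \<mu>\<^sub>0 + b *\<^sub>R A \<mu>"
    by (simp add: A params coeff algebra_simps)
  have inverse: "A \<mu>\<^sub>0 ** B = mat 1" "B ** A \<mu>\<^sub>0 = mat 1"
    using A_inv[OF params(1)] someI_ex[of "\<lambda>X. A \<mu>\<^sub>0 ** X = mat 1 \<and> X ** A \<mu>\<^sub>0 = mat 1"]
    unfolding B matrix_inv_def invertible_def by blast+
  have inverse_t: "transpose B ** transpose (A \<mu>\<^sub>0) = mat 1"
    using inverse(1) by (metis matrix_transpose_mul transpose_mat)
  \<comment> \<open>As \<open>B\<close> inverts \<open>A \<mu>\<^sub>0\<close>, that summand of
    \<open>A \<mu>\<^sub>1\<close> contributes a multiple of the identity.\<close>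
  have affine: "(B ** A \<mu>\<^sub>1) *v x = a *\<^sub>R x + b *\<^sub>R ((B ** A \<mu>) *v x)" for x
  proof -
    have "(B ** A \<mu>\<^sub>1) *v x = a *\<^sub>R ((B ** A \<mu>\<^sub>0) *v x) + b *\<^sub>R ((B ** A \<mu>) *v x)"
      by (simp add: A1 matrix_vector_mult_add_rdistrib matrix_vector_right_distrib
          matrix_vector_mult_scaleR flip: matrix_vector_mul_assoc scaleR_matrix_vector_assoc)
    then show ?thesis by (simp add: inverse)
  qed
  have affine_t: "(transpose B ** transpose (A \<mu>\<^sub>1)) *v x =
      a *\<^sub>R x + b *\<^sub>R ((transpose B ** transpose (A \<mu>)) *v x)" for x
  proof -
    have "transpose (A \<mu>\<^sub>1) = a *\<^sub>R transpose (A \<mu>\<^sub>0) + b *\<^sub>R transpose (A \<mu>)"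
      by (simp add: A1 transpose_def vec_eq_iff)
    then have "(transpose B ** transpose (A \<mu>\<^sub>1)) *v x =
        a *\<^sub>R ((transpose B ** transpose (A \<mu>\<^sub>0)) *v x)
        + b *\<^sub>R ((transpose B ** transpose (A \<mu>)) *v x)"
      by (simp add: matrix_vector_mult_add_rdistrib matrix_vector_right_distrib
          matrix_vector_mult_scaleR flip: matrix_vector_mul_assoc scaleR_matrix_vector_assoc)
    then show ?thesis by (simp add: inverse_t)
  qed
  have idx_less: "idx j < m" for j
    using idx by (auto simp: bij_betw_def)
  have card: "CARD('m) = m"
    using bij_betw_same_card[OF idx] by simp
  have dim_P: "dim (span (columns P)) = m"
    using dim_columns_invertible_mult[OF online_ok] by (simp add: card)
  \<comment> \<open>Transposing the online matrix puts \<open>Q\<close> on the right, where the rank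
    lemma applies to it.\<close>
  have "invertible (transpose (A \<mu> ** P) ** Q)"
    using transpose_invertible[OF online_ok]
    by (simp add: matrix_transpose_mul matrix_mul_assoc)
  then have dim_Q: "dim (span (columns Q)) = m"
    using dim_columns_invertible_mult card by metis
  have "span (columns P) \<subseteq> K"
    using span_columns_rkbm2_P_subset[where idx = idx, OF idx_less] krylov_affine_subset[OF affine]
    unfolding P K by blast
  \<comment> \<open>The contained span has dimension \<open>m\<close>, and \<open>m\<close>
    generators cannot span more.\<close>
  then have K_eq: "span (columns P) = K"
    using dim_P dim_krylov_le subspace_krylov unfolding K
    by (intro subspace_dim_equal) auto
  have "span (columns Q) \<subseteq> L"
    using span_columns_rkbm2_Q_subset[where idx = idx, OF idx_less] krylov_affine_subset[OF affine_t]
    unfolding Q L by blast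
  then have L_eq: "span (columns Q) = L"
    using dim_Q dim_krylov_le subspace_krylov unfolding L
    by (intro subspace_dim_equal) auto
  have dim_K: "dim K = m" and dim_L: "dim L = m"
    using dim_P dim_Q unfolding K_eq L_eq .
  have dim_0: "dim {0 :: real ^ 'n} \<noteq> m"
    using m_pos by simp
  have K_nontrivial: "K \<noteq> {0}"
    using dim_K dim_0 by blast
  have "L \<noteq> {0}"
    using dim_L dim_0 by blast
  moreover have "0 \<in> L"
    unfolding L by (rule subspace_0[OF subspace_krylov])
  ultimately have L_nontrivial: "L - {0} \<noteq> {}"
    by blast
  \<comment> \<open>Replacing \<open>f\<close> by \<open>A \<mu> *v u\<close> turns the online
    equations into Galerkin orthogonality.\<close>
  have "u_hat \<in> K" and "\<And>w. w \<in> L \<Longrightarrow> (A \<mu> *v u_hat) \<bullet> w = (A \<mu> *v u) \<bullet> w"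
    using u_hat unfolding rkbm2_online_solution_def K_eq L_eq u by blast+
  moreover have "subspace K"
    unfolding K by (rule subspace_krylov)
  ultimately show ?thesis
    using petrov_galerkin_quasi_optimal[OF spd const_pos continuity _ K_nontrivial
        L_nontrivial inf_sup] by blast
qed

end
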